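(* Let $a\ge1$, $n\ge1$, $b\ge3$ be integers and let $$P_{a,b,n}(z)=(1+z)^a+\bigl(1+2bz+b(b-1)z^2\bigr)^n-1=\sum_{k=0}^{d}c_kz^k,\qquad d=\max\{a,2n\}.$$ Every coefficient $c_k$ ($0\le k\le d$) is positive, so $P_{a,b,n}(z)$ has no positive real zero. Moreover, every (complex) zero $\zeta$ of $P_{a,b,n}(z)$ satisfies $$\min_{0\le k\le d-1}\frac{c_k}{c_{k+1}}\le|\zeta|\le\max_{0\le k\le d-1}\frac{c_k}{c_{k+1}}.$$
   Context: $P_{a,b,n}(z)$ is the independence polynomial of the graph $\overline{K}_a\nabla(nB_b)$, the join of an edgeless graph on $a$ vertices with $n$ disjoint copies of the graph $B_b$ consisting of two copies of $K_b$ joined by a perfect matching; this is not needed for the statement. *)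

theory Defs
  imports Complex_Main "HOL-Computational_Algebra.Polynomial"
begin

(* Coefficient lists are in increasing degree; b - 1 is formed in the reals, so it does not truncate. *)
definition indep_poly :: "nat \<Rightarrow> nat \<Rightarrow> nat \<Rightarrow> real poly" where
  "indep_poly a b n =
     [:1, 1:] ^ a + [:1, 2 * real b, real b * (real b - 1):] ^ n - 1"

definition coeff_ratios :: "real poly \<Rightarrow> nat \<Rightarrow> real set" where
  "coeff_ratios p d = (\<lambda>k. coeff p k / coeff p (k + 1)) ` {k. k < d}"

end

theory Submission
  imports Defs
begin

text \<open>The bounds on the zeros are the Enestrom--Kakeya theorem. If all ratios
  \<open>c\<^sub>k / c\<^sub>k\<^sub>+\<^sub>1\<close> are at most \<open>R\<close>, then \<open>(z - R) P(z)\<close> has a single coefficient that may be positive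
  (the leading one), and if they are all at least \<open>r\<close>, the same holds for \<open>(r - z) P(z)\<close> (the
  constant one). For a polynomial \<open>Q\<close> with at most one positive coefficient, the triangle
  inequality at a zero \<open>\<zeta>\<close> yields \<open>Q(|\<zeta>|) \<le> 0\<close>; since \<open>P(|\<zeta>|) > 0\<close>, the linear factor is
  nonpositive at \<open>|\<zeta>|\<close>.\<close>

text \<open>The convolution sum has nonnegative terms, so one positive term suffices: the one whose
  index in \<open>p\<close> is as large as possible, \<open>min k (degree p)\<close>, leaving at
  most \<open>degree q\<close> for \<open>q\<close>.\<close>

lemma coeff_mult_pos:
  fixes p q :: "'a :: linordered_idom poly"
  assumes p: "\<And>k. k \<le> degree p \<Longrightarrow> coeff p k > 0"
    and q: "\<And>k. k \<le> degree q \<Longrightarrow> coeff q k > 0"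
    and k: "k \<le> degree p + degree q"
  shows "coeff (p * q) k > 0"
proof -
  have nonneg: "coeff p i \<ge> 0" "coeff q i \<ge> 0" for i
    using p[of i] q[of i] by (cases "i \<le> degree p"; cases "i \<le> degree q";
      simp add: less_imp_le coeff_eq_0)+
  define i where "i = min k (degree p)"
  have "i \<le> k" "i \<le> degree p" "k - i \<le> degree q"
    using k by (auto simp: i_def)
  then have "coeff p i * coeff q (k - i) > 0"
    using p q by simp
  then have "(\<Sum>i\<le>k. coeff p i * coeff q (k - i)) > 0"
    using \<open>i \<le> k\<close> nonneg by (intro sum_pos2[of _ i]) auto
  then show ?thesis
    by (simp add: coeff_mult)
qed

lemma coeff_power_pos:
  fixes p :: "'a :: linordered_idom poly"
  assumes p: "\<And>k. k \<le> degree p \<Longrightarrow> coeff p k > 0"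
    and k: "k \<le> n * degree p"
  shows "coeff (p ^ n) k > 0"
  using k
proof (induction n arbitrary: k)
  case (Suc n)
  have "p \<noteq> 0"
    using p[of 0] by auto
  then have "degree (p ^ n) = n * degree p"
    by (simp add: degree_power_eq)
  then show ?case
    using Suc p by (simp add: coeff_mult_pos)
qed simp

lemma poly_eq_sum_of_degree_le:
  fixes p :: "'a :: comm_semiring_1 poly"
  assumes "degree p \<le> N"
  shows "poly p x = (\<Sum>k\<le>N. coeff p k * x ^ k)"
  unfolding poly_altdef
  using assms by (intro sum.mono_neutral_left) (auto simp: coeff_eq_0)

lemma map_poly_of_real_linear_mult:
  "map_poly complex_of_real ([:c, d:] * p)
    = [:complex_of_real c, complex_of_real d:] * map_poly complex_of_real p"
  by (intro poly_eqI) (simp add: coeff_map_poly coeff_pCons split: nat.split)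

lemma poly_norm_nonpos_at_root:
  fixes p :: "real poly" and z :: complex
  assumes nonpos: "\<And>k. k \<noteq> m \<Longrightarrow> coeff p k \<le> 0"
    and root: "poly (map_poly complex_of_real p) z = 0"
  shows "poly p (norm z) \<le> 0"
proof -
  \<comment> \<open>The index \<open>m\<close> may exceed \<open>degree p\<close>; this bound keeps
    it in the summation range so that its term can be split off.\<close>
  define N where "N = max m (degree p)"
  have m: "m \<in> {..N}" and deg: "degree p \<le> N"
    by (auto simp: N_def)
  have "degree (map_poly complex_of_real p) \<le> N"
    using deg map_poly_degree_leq by (rule order.trans[rotated])
  then have "(\<Sum>k\<le>N. complex_of_real (coeff p k) * z ^ k) = 0"
    using root by (simp add: poly_eq_sum_of_degree_le coeff_map_poly)
  then have "complex_of_real (coeff p m) * z ^ m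
      + (\<Sum>k\<in>{..N} - {m}. complex_of_real (coeff p k) * z ^ k) = 0"
    using sum.remove[OF finite_atMost m] by metis
  then have "norm (complex_of_real (coeff p m) * z ^ m)
      = norm (\<Sum>k\<in>{..N} - {m}. complex_of_real (coeff p k) * z ^ k)"
    by (simp only: add_eq_0_iff2 norm_minus_cancel)
  then have "\<bar>coeff p m\<bar> * norm z ^ m
      = norm (\<Sum>k\<in>{..N} - {m}. complex_of_real (coeff p k) * z ^ k)"
    by (simp only: norm_mult norm_of_real norm_power)
  \<comment> \<open>For \<open>k \<noteq> m\<close> the sign condition turns the absolute value of
    the coefficient into \<open>- coeff p k\<close>.\<close>
  also have "\<dots> \<le> (\<Sum>k\<in>{..N} - {m}. - coeff p k * norm z ^ k)"
    using nonpos by (intro sum_norm_le) (simp add: norm_mult norm_power)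
  finally have "coeff p m * norm z ^ m \<le> (\<Sum>k\<in>{..N} - {m}. - coeff p k * norm z ^ k)"
    using mult_right_mono[OF abs_ge_self, of "norm z ^ m" "coeff p m"] by simp
  then show ?thesis
    using sum.remove[OF finite_atMost m, of "\<lambda>k. coeff p k * norm z ^ k"]
    by (simp add: poly_eq_sum_of_degree_le[OF deg] sum_negf)
qed

lemma poly_pos_of_coeff_pos:
  fixes p :: "'a :: linordered_idom poly"
  assumes "\<And>k. k \<le> degree p \<Longrightarrow> coeff p k > 0" and "x \<ge> 0"
  shows "poly p x > 0"
  unfolding poly_altdef
  \<comment> \<open>The constant term is the strictly positive one, which also covers
    \<open>x = 0\<close>.\<close>
  using assms by (intro sum_pos2[of _ 0]) (auto simp: less_imp_le)

lemma enestrom_kakeya_upper: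
  fixes p :: "real poly" and z :: complex
  assumes pos: "\<And>k. k \<le> degree p \<Longrightarrow> coeff p k > 0"
    and R: "\<And>k. k < degree p \<Longrightarrow> coeff p k \<le> R * coeff p (Suc k)" and "R \<ge> 0"
    and root: "poly (map_poly complex_of_real p) z = 0"
  shows "norm z \<le> R"
proof -
  have "poly ([:- R, 1:] * p) (norm z) \<le> 0"
  proof (rule poly_norm_nonpos_at_root)
    show "coeff ([:- R, 1:] * p) k \<le> 0" if "k \<noteq> Suc (degree p)" for k
      \<comment> \<open>With c_k = \<open>coeff p k\<close>, the coefficient at k is c_(k-1) - R
        c_k. At k = 0 it is - R c_0, hence the need for \<open>R \<ge> 0\<close>; beyond
        \<open>Suc (degree p)\<close> it vanishes.\<close>
      using that pos[of 0] R[of "k - 1"] \<open>R \<ge> 0\<close>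
      by (cases k; cases "k - 1" "degree p" rule: linorder_cases) (simp_all add: coeff_eq_0)
    show "poly (map_poly complex_of_real ([:- R, 1:] * p)) z = 0"
      using root by (simp add: map_poly_of_real_linear_mult del: mult_pCons_left)
  qed
  then show ?thesis
    using poly_pos_of_coeff_pos[OF pos, of "norm z"]
    by (simp add: mult_le_0_iff del: mult_pCons_left)
qed

lemma enestrom_kakeya_lower:
  fixes p :: "real poly" and z :: complex
  assumes pos: "\<And>k. k \<le> degree p \<Longrightarrow> coeff p k > 0"
    and r: "\<And>k. k < degree p \<Longrightarrow> r * coeff p (Suc k) \<le> coeff p k"
    and root: "poly (map_poly complex_of_real p) z = 0"
  shows "r \<le> norm z"
proof -
  have "poly ([:r, - 1:] * p) (norm z) \<le> 0"
  proof (rule poly_norm_nonpos_at_root)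
    show "coeff ([:r, - 1:] * p) k \<le> 0" if "k \<noteq> 0" for k
      \<comment> \<open>The coefficient at k > 0 is r c_k - c_(k-1). At k =
        \<open>Suc (degree p)\<close> it is minus the leading coefficient of \<open>p\<close>, so
        the sign of \<open>r\<close> never matters.\<close>
      using that pos[of "degree p"] r[of "k - 1"]
      by (cases k; cases "k - 1" "degree p" rule: linorder_cases) (auto simp: coeff_eq_0)
    show "poly (map_poly complex_of_real ([:r, - 1:] * p)) z = 0"
      using root by (simp add: map_poly_of_real_linear_mult del: mult_pCons_left)
  qed
  then show ?thesis
    using poly_pos_of_coeff_pos[OF pos, of "norm z"]
    by (simp add: mult_le_0_iff del: mult_pCons_left)
qed

theorem enestrom_kakeya:
  fixes p :: "real poly" and z :: complex
  assumes pos: "\<And>k. k \<le> degree p \<Longrightarrow> coeff p k > 0"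
    and "degree p > 0"
    and root: "poly (map_poly complex_of_real p) z = 0"
  shows "Min (coeff_ratios p (degree p)) \<le> norm z"
    and "norm z \<le> Max (coeff_ratios p (degree p))"
proof -
  let ?S = "coeff_ratios p (degree p)"
  have fin: "finite ?S"
    by (simp add: coeff_ratios_def)
  have mem: "coeff p k / coeff p (Suc k) \<in> ?S" if "k < degree p" for k
    using that by (auto simp: coeff_ratios_def)
  show "Min ?S \<le> norm z"
    using enestrom_kakeya_lower[OF pos _ root] Min_le[OF fin mem] pos
    by (simp add: pos_le_divide_eq Suc_le_eq)
  \<comment> \<open>A single nonnegative ratio makes the maximum nonnegative, as the upper bound
    requires of \<open>R\<close>.\<close>
  have "0 \<le> coeff p 0 / coeff p 1"
    using pos[of 0] pos[of 1] \<open>degree p > 0\<close> by simp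
  then have "Max ?S \<ge> 0"
    using Max_ge[OF fin mem[of 0]] \<open>degree p > 0\<close> by simp
  then show "norm z \<le> Max ?S"
    using enestrom_kakeya_upper[OF pos _ _ root] Max_ge[OF fin mem] pos
    by (simp add: pos_divide_le_eq Suc_le_eq)
qed

text \<open>Subtracting 1 affects only the constant term, which becomes 1 + 1 - 1 = 1. At any other
  index up to the maximum, at least one of the two powers contributes a positive coefficient and the
  other a nonnegative one.\<close>

lemma coeff_indep_poly_pos:
  assumes "b \<ge> 2" and "k \<le> max a (2 * n)"
  shows "coeff (indep_poly a b n) k > 0"
proof -
  let ?p = "[:1, 1:] :: real poly"
  let ?q = "[:1, 2 * real b, real b * (real b - 1):]"
  have q_deg: "degree ?q = 2"
    using assms by simp
  have p: "coeff (?p ^ a) k > 0" if "k \<le> a" for k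
    using that by (intro coeff_power_pos) (auto simp: coeff_pCons split: nat.split)
  have q: "coeff (?q ^ n) k > 0" if "k \<le> 2 * n" for k
    using that assms q_deg
    by (intro coeff_power_pos) (auto simp: coeff_pCons split: nat.split)
  have p_nonneg: "coeff (?p ^ a) k \<ge> 0"
    using p[of k] by (cases "k \<le> a") (auto simp: coeff_eq_0 degree_power_eq)
  have q_nonneg: "coeff (?q ^ n) k \<ge> 0"
    using q[of k] q_deg
    by (cases "k \<le> 2 * n") (auto simp: coeff_eq_0 degree_power_eq)
  show ?thesis
  proof (cases "k = 0")
    case True
    then show ?thesis
      by (simp add: indep_poly_def coeff_0_power)
  next
    case False
    then have "coeff (indep_poly a b n) k = coeff (?p ^ a) k + coeff (?q ^ n) k"
      by (simp add: indep_poly_def coeff_1)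
    moreover have "k \<le> a \<or> k \<le> 2 * n"
      using assms by auto
    ultimately show ?thesis
      using p[of k] q[of k] p_nonneg q_nonneg by auto
  qed
qed

lemma degree_indep_poly:
  assumes "b \<ge> 2"
  shows "degree (indep_poly a b n) = max a (2 * n)"
proof (rule antisym)
  have "degree ([:1, 1:] ^ a :: real poly) \<le> max a (2 * n)"
    by (simp add: degree_power_eq)
  moreover have "degree ([:1, 2 * real b, real b * (real b - 1):] ^ n) \<le> max a (2 * n)"
    using assms by (subst degree_power_eq) auto
  ultimately show "degree (indep_poly a b n) \<le> max a (2 * n)"
    unfolding indep_poly_def by (intro degree_diff_le degree_add_le) auto
  \<comment> \<open>The coefficient at this index is positive, so leading terms cannot cancel, even
    when \<open>a = 2 * n\<close>.\<close>
  show "max a (2 * n) \<le> degree (indep_poly a b n)"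
    using coeff_indep_poly_pos[OF assms order.refl, of a n] by (intro le_degree) simp
qed

theorem theorem8p7:
  fixes a b n d :: nat and P :: "real poly"
  assumes "a \<ge> 1" and "n \<ge> 1" and "b \<ge> 3"
  defines "P \<equiv> indep_poly a b n" and "d \<equiv> max a (2 * n)"
  shows "degree P = d
    \<and> (\<forall>k\<le>d. coeff P k > 0)
    \<and> (\<forall>x::real. x > 0 \<longrightarrow> poly P x \<noteq> 0)
    \<and> (\<forall>\<zeta>::complex. poly (map_poly complex_of_real P) \<zeta> = 0 \<longrightarrow>
          Min (coeff_ratios P d) \<le> norm \<zeta> \<and> norm \<zeta> \<le> Max (coeff_ratios P d))"
proof -
  have deg: "degree P = d"
    using degree_indep_poly \<open>b \<ge> 3\<close> by (simp add: P_def d_def)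
  have pos: "coeff P k > 0" if "k \<le> degree P" for k
    using coeff_indep_poly_pos that deg \<open>b \<ge> 3\<close> by (simp add: P_def d_def)
  have "degree P > 0"
    using \<open>a \<ge> 1\<close> by (simp add: deg d_def)
  then have "Min (coeff_ratios P d) \<le> norm \<zeta> \<and> norm \<zeta> \<le> Max (coeff_ratios P d)"
    if "poly (map_poly complex_of_real P) \<zeta> = 0" for \<zeta>
    using enestrom_kakeya[OF pos] that by (simp add: deg)
  moreover have "poly P x \<noteq> 0" if "x > 0" for x
    using poly_pos_of_coeff_pos[OF pos, of x] that by simp
  ultimately show ?thesis
    using deg pos by blast
qed

end
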